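(* Let $P\subset\mathbb{R}^n$ be a convex body containing $0$ in its interior. For any $\delta>0$ there is a constant $C_\delta$ such that $$\mathcal{G}(\phi)\le(1-\delta)\,\bar{\mathcal{E}}(\phi)+C_\delta$$ for any normalized $\phi\in\mathcal{P}_+(\mathbb{R}^n)$, i.e. such that $\phi(0)=0$ and $\phi\ge0$. Moreover, the following are equivalent: $\mathcal{G}$ is bounded from above on $\mathcal{P}_+(\mathbb{R}^n)$; $\mathcal{G}$ is invariant under the action of $\mathbb{R}^n$ by translations $\phi\mapsto\phi(\cdot+a)$; $0$ is the barycenter of $P$.
   Context: $\phi_P(x)=\sup_{p\in P}\langle x,p\rangle$ is the support function of $P$, and $\mathcal{P}_+(\mathbb{R}^n)$ is the space of convex functions $\phi$ on $\mathbb{R}^n$ such that $\phi-\phi_P$ is bounded. $\phi^*(p)=\sup_x(\langle p,x\rangle-\phi(x))$ is the Legendre transform. The volume-normalized energy and the Moser-Trudinger type functional are $$\bar{\mathcal{E}}(\phi):=-\frac1{\mathrm{Vol}(P)}\int_P\phi^*\,dp,\qquad\mathcal{G}(\phi):=\bar{\mathcal{E}}(\phi)+\log\int_{\mathbb{R}^n}e^{-\phi}dx .$$ The barycenter is with respect to Lebesgue measure on $P$. *)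

theory Defs
  imports "HOL-Analysis.Analysis"
begin

definition support_fun :: "'a::euclidean_space set \<Rightarrow> 'a \<Rightarrow> real" where
  "support_fun P x = (SUP p\<in>P. x \<bullet> p)"

definition Pplus :: "'a::euclidean_space set \<Rightarrow> ('a \<Rightarrow> real) set" where
  "Pplus P = {\<phi>. convex_on UNIV \<phi> \<and> bounded (range (\<lambda>x. \<phi> x - support_fun P x))}"

text \<open>
  For \<open>\<phi>\<close> in \<open>Pplus P\<close> the Legendre transform is finite on \<open>P\<close> (see the next lemma), and it is
  only ever evaluated there; so the supremum is taken in the reals. Outside \<open>P\<close>, where the
  transform is infinite when \<open>P\<close> is compact and convex, the value is meaningless.
\<close>

definition legendre :: "('a::euclidean_space \<Rightarrow> real) \<Rightarrow> 'a \<Rightarrow> real" where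
  "legendre \<phi> p = (SUP x. p \<bullet> x - \<phi> x)"

lemma legendre_bdd_above:
  fixes P :: "'a::euclidean_space set"
  assumes "bounded P" "\<phi> \<in> Pplus P" "p \<in> P"
  shows "bdd_above (range (\<lambda>x. p \<bullet> x - \<phi> x))"
proof -
  obtain C where C: "\<And>x. \<bar>\<phi> x - support_fun P x\<bar> \<le> C"
    using assms(2) by (auto simp: Pplus_def bounded_iff)
  have "p \<bullet> x - \<phi> x \<le> C" for x
  proof -
    have "bounded ((\<lambda>q. x \<bullet> q) ` P)"
      using assms(1) bounded_linear_image bounded_linear_inner_right by blast
    then have "x \<bullet> p \<le> support_fun P x"
      unfolding support_fun_def
      using assms(3) by (intro cSUP_upper bounded_imp_bdd_above) auto
    then show ?thesis
      using C[of x] by (simp add: inner_commute abs_le_iff)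
  qed
  then show ?thesis
    by (intro bdd_aboveI[of _ C]) auto
qed

definition energy :: "'a::euclidean_space set \<Rightarrow> ('a \<Rightarrow> real) \<Rightarrow> real" where
  "energy P \<phi> = - (1 / measure lborel P) * (LINT p:P|lborel. legendre \<phi> p)"

definition MT_functional :: "'a::euclidean_space set \<Rightarrow> ('a \<Rightarrow> real) \<Rightarrow> real" where
  "MT_functional P \<phi> = energy P \<phi> + ln (LINT x|lborel. exp (- \<phi> x))"

definition barycenter :: "'a::euclidean_space set \<Rightarrow> 'a" where
  "barycenter P = (1 / measure lborel P) *\<^sub>R (LINT p:P|lborel. p)"

end

theory Submission
  imports Defs
begin

text \<open>
  Write \<open>\<phi>\<^sup>*\<close> for the Legendre transform, \<open>E\<close> for the energy, \<open>G\<close> for the functional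
  \<open>MT_functional P\<close>, and fix \<open>r > 0\<close> with \<open>cball 0 r \<subseteq> P\<close>.

  The inequality for normalized \<open>\<phi>\<close> follows from a pointwise lower bound on \<open>\<phi>\<close> in terms of the
  energy. Given \<open>x\<close>, every \<open>p\<close> in the ball of radius \<open>r / 4\<close> about the point at distance \<open>3 * r / 4\<close>
  from \<open>0\<close> in the direction of \<open>x\<close> satisfies \<open>\<phi>\<^sup>* p \<ge> p \<bullet> x - \<phi> x \<ge> r / 2 * norm x - \<phi> x\<close>. Since
  \<open>\<phi>\<^sup>* \<ge> 0\<close> on \<open>P\<close> when \<open>\<phi> 0 = 0\<close>, integration gives
  \<open>\<phi> x \<ge> r / 2 * norm x + K * E \<phi>\<close>, where \<open>K\<close> is the ratio of the volumes of \<open>P\<close> and of that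
  ball (lemma \<open>legendre_integral_lower_bound\<close>). As \<open>\<phi> \<ge> 0\<close>, the bound may be multiplied by any
  \<open>t\<close> with \<open>0 < t \<le> 1\<close>; choosing \<open>t * K \<le> \<delta>\<close> and using \<open>E \<phi> \<le> 0\<close> yields
  \<open>\<phi> x \<ge> t * r / 2 * norm x + \<delta> * E \<phi>\<close>. Integrating \<open>exp (- \<phi> x)\<close> bounds the logarithmic term by
  \<open>- \<delta> * E \<phi> + C\<close> (lemma \<open>MT_functional_le_energy\<close>).

  The equivalences follow from the transformation law
  \<open>G (\<lambda>x. \<phi> (x + a) + c) = G \<phi> + a \<bullet> barycenter P\<close> (lemma \<open>MT_functional_shift\<close>). It shows at once
  that invariance under translations means that the barycenter vanishes, and that \<open>G\<close> is unbounded
  along the translates of the support function otherwise. Conversely, if the barycenter is \<open>0\<close>, then,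
  since each \<open>\<phi>\<close> in \<open>Pplus P\<close> is coercive and so attains its minimum, it can be normalized without
  changing \<open>G\<close>, and the inequality with \<open>\<delta> = 1\<close> bounds \<open>G\<close>.
\<close>

section \<open>Integrals of exponentials of coercive functions\<close>

lemma nn_integral_exp_minus_abs_finite:
  fixes c :: real
  assumes "c > 0"
  shows "(\<integral>\<^sup>+x. ennreal (exp (- c * \<bar>x\<bar>)) \<partial>lborel) < \<infinity>"
proof -
  define f where "f = (\<lambda>x::real. ennreal (exp (- c * x)) * indicator {0..} x)"
  have [measurable]: "f \<in> borel_measurable borel"
    unfolding f_def by measurable
  have "((\<lambda>x. - exp (- c * x) / c) \<longlongrightarrow> - 0 / c) at_top"
    using assms
    by (intro tendsto_divide tendsto_minus filterlim_compose[OF exp_at_bot]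
        filterlim_tendsto_neg_mult_at_bot[OF tendsto_const] filterlim_ident) auto
  then have "(\<integral>\<^sup>+x. f x \<partial>lborel) = ennreal (- 0 / c - (- exp (- c * 0) / c))"
    unfolding f_def using assms
    by (intro nn_integral_FTC_atLeast) (auto intro!: derivative_eq_intros)
  then have fin: "(\<integral>\<^sup>+x. f x \<partial>lborel) < \<infinity>"
    by simp
  have "(\<integral>\<^sup>+x. ennreal (exp (- c * \<bar>x\<bar>)) \<partial>lborel) \<le> (\<integral>\<^sup>+x. f x + f (- x) \<partial>lborel)"
    by (intro nn_integral_mono) (auto simp: f_def indicator_def abs_if)
  also have "\<dots> = (\<integral>\<^sup>+x. f x \<partial>lborel) + (\<integral>\<^sup>+x. f (- x) \<partial>lborel)"
    by (intro nn_integral_add) auto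
  also have "(\<integral>\<^sup>+x. f (- x) \<partial>lborel) = (\<integral>\<^sup>+x. f x \<partial>lborel)"
    using nn_integral_real_affine[of f "-1" 0] by simp
  finally show ?thesis
    using fin by (simp add: top.not_eq_extremum order_le_less_trans ennreal_add_eq_top)
qed

lemma integrable_exp_minus_norm:
  fixes c :: real
  assumes "c > 0"
  shows "integrable lborel (\<lambda>x::'a::euclidean_space. exp (- c * norm x))"
proof (rule integrableI_bounded)
  define d where "d = c / DIM('a)"
  have d: "d > 0"
    using assms by (simp add: d_def)
  \<comment> \<open>Comparing with the \<open>\<ell>\<^sup>1\<close> norm makes the majorant a product over the coordinates.\<close>
  have "exp (- c * norm x) \<le> (\<Prod>b\<in>Basis. exp (- d * \<bar>x \<bullet> b\<bar>))" for x :: 'a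
  proof -
    have "(\<Sum>b\<in>Basis. \<bar>x \<bullet> b\<bar>) \<le> (\<Sum>b\<in>(Basis::'a set). norm x)"
      by (intro sum_mono Basis_le_norm)
    then have "d * (\<Sum>b\<in>Basis. \<bar>x \<bullet> b\<bar>) \<le> d * (DIM('a) * norm x)"
      using d by (intro mult_left_mono) auto
    also have "\<dots> = c * norm x"
      by (simp add: d_def)
    finally show ?thesis
      by (simp add: exp_sum[symmetric] sum_distrib_left sum_negf)
  qed
  then have "(\<integral>\<^sup>+(x::'a). ennreal (norm (exp (- c * norm x))) \<partial>lborel)
      \<le> (\<integral>\<^sup>+(x::'a). (\<Prod>b\<in>Basis. ennreal (exp (- d * \<bar>x \<bullet> b\<bar>))) \<partial>lborel)"
    by (intro nn_integral_mono) (simp add: prod_ennreal ennreal_leI)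
  also have "\<dots> = (\<Prod>b\<in>(Basis::'a set). (\<integral>\<^sup>+x. ennreal (exp (- d * \<bar>x\<bar>)) \<partial>lborel))"
    by (intro nn_integral_lborel_prod) auto
  also have "\<dots> < \<infinity>"
    using nn_integral_exp_minus_abs_finite[OF d] by (simp add: power_less_top_ennreal)
  finally show "(\<integral>\<^sup>+(x::'a). ennreal (norm (exp (- c * norm x))) \<partial>lborel) < \<infinity>" .
qed simp

lemma integral_exp_minus_pos:
  fixes \<phi> :: "'a::euclidean_space \<Rightarrow> real"
  assumes "integrable lborel (\<lambda>x. exp (- \<phi> x))"
  shows "(LINT x|lborel. exp (- \<phi> x)) > 0"
proof -
  have "(LINT x|lborel. exp (- \<phi> x)) \<noteq> 0"
  proof
    assume "(LINT x|lborel. exp (- \<phi> x)) = 0"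
    then have "AE x in lborel. exp (- \<phi> x) = 0"
      by (subst (asm) integral_nonneg_eq_0_iff_AE[OF assms]) auto
    then have "AE x in (lborel::'a measure). False"
      by simp
    then show False
      by (simp add: AE_iff_measurable[OF _ refl] emeasure_lborel_UNIV)
  qed
  moreover have "(LINT x|lborel. exp (- \<phi> x)) \<ge> 0"
    by simp
  ultimately show ?thesis
    by linarith
qed

lemma integrable_exp_minus_coercive:
  fixes \<phi> :: "'a::euclidean_space \<Rightarrow> real"
  assumes "continuous_on UNIV \<phi>" "c > 0" "\<And>x. \<phi> x \<ge> c * norm x - C"
  shows "integrable lborel (\<lambda>x. exp (- \<phi> x))"
proof (rule Bochner_Integration.integrable_bound)
  show "integrable lborel (\<lambda>x::'a. exp C * exp (- c * norm x))"
    using integrable_exp_minus_norm[OF assms(2)] by simp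
  show "(\<lambda>x. exp (- \<phi> x)) \<in> borel_measurable lborel"
    using assms(1) by (simp add: borel_measurable_continuous_onI continuous_intros)
  have "exp (- \<phi> x) \<le> exp C * exp (- c * norm x)" for x
    using assms(3)[of x] by (simp add: exp_add[symmetric])
  then show "AE x in lborel. norm (exp (- \<phi> x)) \<le> norm (exp C * exp (- c * norm x))"
    by simp
qed

lemma ln_integral_exp_minus_le:
  fixes \<phi> :: "'a::euclidean_space \<Rightarrow> real"
  assumes "continuous_on UNIV \<phi>" "c > 0" "\<And>x. \<phi> x \<ge> c * norm x - C"
  shows "ln (LINT x|lborel. exp (- \<phi> x)) \<le> C + ln (LINT x|(lborel::'a measure). exp (- c * norm x))"
proof -
  have int: "integrable lborel (\<lambda>x::'a. exp (- c * norm x))"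
    by (rule integrable_exp_minus_norm[OF assms(2)])
  have pos: "(LINT x|(lborel::'a measure). exp (- c * norm x)) > 0"
    using integral_exp_minus_pos[of "\<lambda>x::'a. c * norm x"] int by simp
  note int\<phi> = integrable_exp_minus_coercive[OF assms]
  have "exp (- \<phi> x) \<le> exp C * exp (- c * norm x)" for x
    using assms(3)[of x] by (simp add: exp_add[symmetric])
  then have "(LINT x|lborel. exp (- \<phi> x)) \<le> (LINT x|(lborel::'a measure). exp C * exp (- c * norm x))"
    using int\<phi> int by (intro integral_mono) auto
  then have "ln (LINT x|lborel. exp (- \<phi> x)) \<le> ln (exp C * (LINT x|(lborel::'a measure). exp (- c * norm x)))"
    using integral_exp_minus_pos[OF int\<phi>] pos by simp
  also have "\<dots> = C + ln (LINT x|(lborel::'a measure). exp (- c * norm x))"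
    using pos by (simp add: ln_mult)
  finally show ?thesis .
qed

section \<open>Support functions and functions at bounded distance from them\<close>

lemma inner_le_support_fun:
  assumes "bounded P" "p \<in> P"
  shows "x \<bullet> p \<le> support_fun P x"
proof -
  have "bounded ((\<lambda>q. x \<bullet> q) ` P)"
    using assms(1) bounded_linear_image bounded_linear_inner_right by blast
  then show ?thesis
    unfolding support_fun_def using assms(2) by (intro cSUP_upper bounded_imp_bdd_above) auto
qed

lemma support_fun_le:
  assumes "P \<noteq> {}" "\<And>p. p \<in> P \<Longrightarrow> x \<bullet> p \<le> c"
  shows "support_fun P x \<le> c"
  unfolding support_fun_def using assms by (intro cSUP_least) auto

lemma norm_le_support_fun:
  assumes "bounded P" "cball 0 r \<subseteq> P" "r > 0"
  shows "r * norm x \<le> support_fun P x"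
proof -
  have "(r / norm x) *\<^sub>R x \<in> P"
    using assms(2,3) by (intro subsetD[OF assms(2)]) simp
  from inner_le_support_fun[OF assms(1) this, of x] show ?thesis
    by (cases "x = 0") (simp_all add: power2_norm_eq_inner[symmetric] power2_eq_square)
qed

lemma support_fun_in_Pplus:
  fixes P :: "'a::euclidean_space set"
  assumes "bounded P" "P \<noteq> {}"
  shows "support_fun P \<in> Pplus P"
proof -
  have "convex_on UNIV (support_fun P)"
  proof (rule convex_onI)
    fix t :: real and x y :: 'a
    assume t: "0 < t" "t < 1"
    show "support_fun P ((1 - t) *\<^sub>R x + t *\<^sub>R y) \<le> (1 - t) * support_fun P x + t * support_fun P y"
    proof (rule support_fun_le[OF assms(2)])
      fix p assume "p \<in> P"
      from inner_le_support_fun[OF assms(1) this] t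
      show "((1 - t) *\<^sub>R x + t *\<^sub>R y) \<bullet> p \<le> (1 - t) * support_fun P x + t * support_fun P y"
        by (auto simp: inner_left_distrib intro!: add_mono mult_left_mono)
    qed
  qed simp
  then show ?thesis
    by (simp add: Pplus_def image_constant_conv)
qed

lemma Pplus_continuous:
  "\<phi> \<in> Pplus P \<Longrightarrow> continuous_on UNIV \<phi>"
  unfolding Pplus_def by (auto intro: convex_on_continuous)

lemma PplusE:
  assumes "\<phi> \<in> Pplus P"
  obtains C where "\<And>x. \<bar>\<phi> x - support_fun P x\<bar> \<le> C"
  using assms by (auto simp: Pplus_def bounded_iff)

lemma Pplus_shift:
  fixes P :: "'a::euclidean_space set"
  assumes "bounded P" "P \<noteq> {}" "\<phi> \<in> Pplus P"
  shows "(\<lambda>x. \<phi> (x + a) + c) \<in> Pplus P"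
proof -
  obtain C where C: "\<And>x. \<bar>\<phi> x - support_fun P x\<bar> \<le> C"
    using assms(3) by (rule PplusE) blast
  obtain R where R: "\<And>p. p \<in> P \<Longrightarrow> norm p \<le> R"
    using assms(1) by (auto simp: bounded_iff)
  have lip: "support_fun P (x + b) \<le> support_fun P x + R * norm b" for x b
  proof (rule support_fun_le[OF assms(2)])
    fix p assume p: "p \<in> P"
    have "b \<bullet> p \<le> norm b * norm p"
      by (rule norm_cauchy_schwarz)
    also have "\<dots> \<le> norm b * R"
      using R[OF p] by (intro mult_left_mono) auto
    finally show "(x + b) \<bullet> p \<le> support_fun P x + R * norm b"
      using inner_le_support_fun[OF assms(1) p, of x] by (simp add: inner_left_distrib mult.commute)
  qed
  have "\<bar>\<phi> (x + a) + c - support_fun P x\<bar> \<le> C + R * norm a + \<bar>c\<bar>" for x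
    using C[of "x + a"] lip[of x a] lip[of "x + a" "- a"] by simp
  then have "bounded (range (\<lambda>x. \<phi> (x + a) + c - support_fun P x))"
    by (auto simp: bounded_iff)
  moreover have "convex_on UNIV (\<lambda>x. \<phi> (x + a) + c)"
  proof (rule convex_onI)
    fix t :: real and x y :: 'a
    assume t: "0 < t" "t < 1"
    have "convex_on UNIV \<phi>"
      using assms(3) by (simp add: Pplus_def)
    from convex_onD[OF this, of t "x + a" "y + a"] t
    have "\<phi> ((1 - t) *\<^sub>R (x + a) + t *\<^sub>R (y + a)) \<le> (1 - t) * \<phi> (x + a) + t * \<phi> (y + a)"
      by simp
    moreover have "(1 - t) *\<^sub>R (x + a) + t *\<^sub>R (y + a) = (1 - t) *\<^sub>R x + t *\<^sub>R y + a"
      by (simp add: algebra_simps)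
    ultimately show "\<phi> ((1 - t) *\<^sub>R x + t *\<^sub>R y + a) + c
        \<le> (1 - t) * (\<phi> (x + a) + c) + t * (\<phi> (y + a) + c)"
      by (simp add: algebra_simps)
  qed simp
  ultimately show ?thesis
    by (simp add: Pplus_def)
qed

lemma Pplus_coercive:
  assumes "bounded P" "cball 0 r \<subseteq> P" "r > 0" "\<phi> \<in> Pplus P"
  obtains C where "\<And>x. \<phi> x \<ge> r * norm x - C"
proof -
  obtain C where C: "\<And>x. \<bar>\<phi> x - support_fun P x\<bar> \<le> C"
    using assms(4) by (rule PplusE) blast
  have "\<phi> x \<ge> r * norm x - C" for x
    using C[of x] norm_le_support_fun[OF assms(1-3), of x] by simp
  then show thesis
    by (rule that)
qed

lemma coercive_attains_minimum:
  fixes \<phi> :: "'a::euclidean_space \<Rightarrow> real"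
  assumes "continuous_on UNIV \<phi>" "r > 0" "\<And>x. \<phi> x \<ge> r * norm x - C"
  obtains z where "\<And>x. \<phi> z \<le> \<phi> x"
proof -
  define R where "R = max 0 ((\<phi> 0 + C) / r)"
  obtain z where z: "z \<in> cball 0 R" "\<And>x. x \<in> cball 0 R \<Longrightarrow> \<phi> z \<le> \<phi> x"
    using continuous_attains_inf[of "cball 0 R" \<phi>] continuous_on_subset[OF assms(1), of "cball 0 R"]
    by (auto simp: R_def)
  have "\<phi> z \<le> \<phi> x" for x
  proof (cases "norm x \<le> R")
    case False
    then have "(\<phi> 0 + C) / r \<le> norm x"
      by (simp add: R_def)
    then have "\<phi> 0 \<le> r * norm x - C"
      using assms(2) by (simp add: field_simps)
    moreover have "\<phi> z \<le> \<phi> 0"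
      by (rule z(2)) (simp add: R_def)
    ultimately show ?thesis
      using assms(3)[of x] by linarith
  qed (use z in simp)
  then show thesis
    by (rule that)
qed

section \<open>Legendre transform\<close>

lemma inner_minus_le_legendre:
  assumes "bounded P" "\<phi> \<in> Pplus P" "p \<in> P"
  shows "p \<bullet> x - \<phi> x \<le> legendre \<phi> p"
  unfolding legendre_def by (intro cSUP_upper legendre_bdd_above[OF assms]) simp

lemma legendre_le:
  assumes "\<And>x. p \<bullet> x - \<phi> x \<le> c"
  shows "legendre \<phi> p \<le> c"
  unfolding legendre_def using assms by (intro cSUP_least) auto

lemma legendre_shift:
  fixes P :: "'a::euclidean_space set"
  assumes "bounded P" "\<phi> \<in> Pplus P" "p \<in> P"
  shows "legendre (\<lambda>x. \<phi> (x + a) + c) p = legendre \<phi> p - a \<bullet> p - c"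
proof (rule antisym)
  show "legendre (\<lambda>x. \<phi> (x + a) + c) p \<le> legendre \<phi> p - a \<bullet> p - c"
  proof (rule legendre_le)
    fix x show "p \<bullet> x - (\<phi> (x + a) + c) \<le> legendre \<phi> p - a \<bullet> p - c"
      using inner_minus_le_legendre[OF assms, of "x + a"]
      by (simp add: inner_right_distrib inner_commute)
  qed
  have "P \<noteq> {}"
    using assms(3) by auto
  note \<psi> = Pplus_shift[OF assms(1) this assms(2), of a c]
  have "legendre \<phi> p \<le> legendre (\<lambda>x. \<phi> (x + a) + c) p + a \<bullet> p + c"
  proof (rule legendre_le)
    fix x show "p \<bullet> x - \<phi> x \<le> legendre (\<lambda>x. \<phi> (x + a) + c) p + a \<bullet> p + c"
      using inner_minus_le_legendre[OF assms(1) \<psi> assms(3), of "x - a"]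
      by (simp add: inner_diff_right inner_commute)
  qed
  then show "legendre \<phi> p - a \<bullet> p - c \<le> legendre (\<lambda>x. \<phi> (x + a) + c) p"
    by simp
qed

text \<open>
  On \<open>P\<close> the transform is bounded, and it is lower semicontinuous there as a supremum of continuous
  functions, hence measurable.
\<close>

lemma set_integrable_legendre:
  fixes P :: "'a::euclidean_space set"
  assumes "compact P" "\<phi> \<in> Pplus P"
  shows "set_integrable lborel P (legendre \<phi>)"
proof -
  have bdd: "bounded P" and [measurable]: "P \<in> sets borel"
    using assms(1) by (auto simp: compact_imp_bounded borel_compact)
  obtain C where C: "\<And>x. \<bar>\<phi> x - support_fun P x\<bar> \<le> C"
    using assms(2) by (rule PplusE) blast
  have upper: "legendre \<phi> p \<le> C" if "p \<in> P" for p
  proof (rule legendre_le)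
    fix x show "p \<bullet> x - \<phi> x \<le> C"
      using C[of x] inner_le_support_fun[OF bdd that, of x] by (simp add: inner_commute)
  qed
  have lower: "- \<phi> 0 \<le> legendre \<phi> p" if "p \<in> P" for p
    using inner_minus_le_legendre[OF bdd assms(2) that, of 0] by simp
  have "legendre \<phi> \<in> borel_measurable (restrict_space lborel P)"
  proof (rule borel_measurableI_greater)
    fix y
    have "{p \<in> P. y < legendre \<phi> p} = P \<inter> (\<Union>x. {p. y < p \<bullet> x - \<phi> x})"
    proof (intro set_eqI iffI)
      fix p assume "p \<in> {p \<in> P. y < legendre \<phi> p}"
      then show "p \<in> P \<inter> (\<Union>x. {p. y < p \<bullet> x - \<phi> x})"
        using legendre_le[of p \<phi> y] by (force simp: not_less)
    next
      fix p assume "p \<in> P \<inter> (\<Union>x. {p. y < p \<bullet> x - \<phi> x})"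
      then show "p \<in> {p \<in> P. y < legendre \<phi> p}"
        using inner_minus_le_legendre[OF bdd assms(2)] by (force intro: less_le_trans)
    qed
    moreover have "open (\<Union>x. {p. y < p \<bullet> x - \<phi> x})"
      by (intro open_UN ballI open_Collect_less continuous_intros)
    ultimately show "{p \<in> space (restrict_space lborel P). y < legendre \<phi> p}
        \<in> sets (restrict_space lborel P)"
      by (auto simp: sets_restrict_space space_restrict_space)
  qed
  then have meas: "(\<lambda>p. indicator P p *\<^sub>R legendre \<phi> p) \<in> borel_measurable lborel"
    by (subst (asm) borel_measurable_restrict_space_iff) auto
  show ?thesis
    unfolding set_integrable_def
  proof (rule Bochner_Integration.integrable_bound[OF _ meas])
    show "integrable lborel (\<lambda>p. indicator P p *\<^sub>R (\<bar>C\<bar> + \<bar>\<phi> 0\<bar>))"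
      by (intro borel_integrable_compact[OF assms(1)] continuous_intros)
    show "AE p in lborel. norm (indicator P p *\<^sub>R legendre \<phi> p)
        \<le> norm (indicator P p *\<^sub>R (\<bar>C\<bar> + \<bar>\<phi> 0\<bar>))"
      using upper lower by (intro AE_I2) (force simp: indicator_def)
  qed
qed

section \<open>Behaviour under translations and addition of constants\<close>

lemma measure_lborel_pos_if_cball_subset:
  fixes P :: "'a::euclidean_space set"
  assumes "compact P" "cball x r \<subseteq> P" "r > 0"
  shows "measure lborel P > 0"
proof -
  have "0 < measure lborel (ball x r)"
    using assms(3) content_ball_pos[of r x] by (simp add: measure_completion)
  also have "\<dots> \<le> measure lborel P"
  proof (rule measure_mono_fmeasurable)
    show "ball x r \<subseteq> P"
      using assms(2) ball_subset_cball by blast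
    show "P \<in> fmeasurable lborel"
      using assms(1) by (simp add: fmeasurable_compact)
  qed simp
  finally show ?thesis .
qed

lemma energy_shift:
  fixes P :: "'a::euclidean_space set"
  assumes "compact P" "measure lborel P > 0" "\<phi> \<in> Pplus P"
  shows "energy P (\<lambda>x. \<phi> (x + a) + c) = energy P \<phi> + a \<bullet> barycenter P + c"
proof -
  have bdd: "bounded P" and P[measurable]: "P \<in> sets borel"
    using assms(1) by (auto simp: compact_imp_bounded borel_compact)
  have id: "set_integrable lborel P (\<lambda>p. p)"
    unfolding set_integrable_def by (intro borel_integrable_compact assms(1) continuous_intros)
  have const: "set_integrable lborel P (\<lambda>p. c)"
    unfolding set_integrable_def by (intro borel_integrable_compact assms(1) continuous_intros)
  have inner: "set_integrable lborel P (\<lambda>p. a \<bullet> p)"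
    unfolding set_integrable_def by (intro borel_integrable_compact assms(1) continuous_intros)
  have "(LINT p:P|lborel. legendre (\<lambda>x. \<phi> (x + a) + c) p)
      = (LINT p:P|lborel. legendre \<phi> p - a \<bullet> p - c)"
    using legendre_shift[OF bdd assms(3)] P by (intro set_lebesgue_integral_cong) auto
  also have "\<dots> = (LINT p:P|lborel. legendre \<phi> p) - (LINT p:P|lborel. a \<bullet> p) - (LINT p:P|lborel. c)"
    using set_integrable_legendre[OF assms(1,3)] inner const by simp
  also have "(LINT p:P|lborel. a \<bullet> p) = a \<bullet> (LINT p:P|lborel. p)"
    using integral_inner_right[of a lborel "\<lambda>p. indicator P p *\<^sub>R p"] id
    by (simp add: set_lebesgue_integral_def set_integrable_def)
  also have "(LINT p:P|lborel. c) = measure lborel P * c"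
    using assms(1) by (subst set_integral_const) (auto simp: emeasure_compact_finite[THEN less_imp_neq, simplified])
  finally show ?thesis
    using assms(2) by (simp add: energy_def barycenter_def field_simps)
qed

lemma MT_functional_shift:
  fixes P :: "'a::euclidean_space set"
  assumes "compact P" "cball 0 r \<subseteq> P" "r > 0" "\<phi> \<in> Pplus P"
  shows "MT_functional P (\<lambda>x. \<phi> (x + a) + c) = MT_functional P \<phi> + a \<bullet> barycenter P"
proof -
  obtain C where C: "\<And>x. \<phi> x \<ge> r * norm x - C"
    using Pplus_coercive[OF compact_imp_bounded[OF assms(1)] assms(2-4)] by blast
  note int = integrable_exp_minus_coercive[OF Pplus_continuous[OF assms(4)] assms(3) C]
  have "(LINT x|lborel. exp (- \<phi> x)) = (LINT x|distr lborel borel ((+) a). exp (- \<phi> x))"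
    by (simp add: lborel_distr_plus)
  also have "\<dots> = (LINT x|lborel. exp (- \<phi> (a + x)))"
    using borel_measurable_integrable[OF int] by (subst integral_distr) auto
  finally have "(LINT x|lborel. exp (- \<phi> (x + a))) = (LINT x|lborel. exp (- \<phi> x))"
    by (simp add: add.commute)
  moreover have "exp (- (\<phi> (x + a) + c)) = exp (- c) * exp (- \<phi> (x + a))" for x
    by (simp add: exp_add[symmetric])
  ultimately have "(LINT x|lborel. exp (- (\<phi> (x + a) + c)))
      = exp (- c) * (LINT x|lborel. exp (- \<phi> x))"
    by simp
  then have "ln (LINT x|lborel. exp (- (\<phi> (x + a) + c))) = ln (LINT x|lborel. exp (- \<phi> x)) - c"
    using integral_exp_minus_pos[OF int] by (simp add: ln_mult)
  then show ?thesis
    using energy_shift[OF assms(1) measure_lborel_pos_if_cball_subset[OF assms(1-3)] assms(4), of a c]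
    by (simp add: MT_functional_def)
qed

section \<open>Moser-Trudinger inequality\<close>

lemma legendre_integral_lower_bound:
  fixes P :: "'a::euclidean_space set"
  assumes "compact P" "cball 0 r \<subseteq> P" "r > 0" "\<phi> \<in> Pplus P" "\<phi> 0 = 0"
  shows "(LINT p:P|lborel. legendre \<phi> p)
    \<ge> measure lborel (cball (0::'a) (r / 4)) * (r / 2 * norm x - \<phi> x)"
proof -
  have bdd: "bounded P"
    using assms(1) by (rule compact_imp_bounded)
  \<comment> \<open>For \<open>x = 0\<close> division by zero gives \<open>q = 0\<close>, for which the estimates below still hold.\<close>
  define q where "q = (3 * r / 4 / norm x) *\<^sub>R x"
  define B where "B = cball q (r / 4)"
  have q: "norm q \<le> 3 * r / 4" "q \<bullet> x = 3 * r / 4 * norm x"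
    using assms(3) by (auto simp: q_def power2_norm_eq_inner[symmetric] power2_eq_square)
  have B: "norm (p - q) \<le> r / 4" if "p \<in> B" for p
    using that by (simp add: B_def dist_norm norm_minus_commute)
  have BP: "p \<in> P" if "p \<in> B" for p
    using norm_triangle_sub[of p q] B[OF that] q(1) by (intro subsetD[OF assms(2)]) simp
  have lower: "r / 2 * norm x - \<phi> x \<le> legendre \<phi> p" if "p \<in> B" for p
  proof -
    have "- ((p - q) \<bullet> x) \<le> norm (p - q) * norm x"
      using Cauchy_Schwarz_ineq2[of "p - q" x] by linarith
    also have "\<dots> \<le> r / 4 * norm x"
      using B[OF that] by (intro mult_right_mono) auto
    finally have "r / 2 * norm x \<le> p \<bullet> x"
      using q(2) by (simp add: inner_diff_left)
    then show ?thesis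
      using inner_minus_le_legendre[OF bdd assms(4) BP[OF that], of x] by simp
  qed
  have nonneg: "0 \<le> legendre \<phi> p" if "p \<in> P" for p
    using inner_minus_le_legendre[OF bdd assms(4) that, of 0] assms(5) by simp
  have "measure lborel B = measure lborel (cball (0::'a) (r / 4))"
    unfolding B_def using assms(3) by (simp add: content_cball)
  then have "measure lborel (cball (0::'a) (r / 4)) * (r / 2 * norm x - \<phi> x)
      = (LINT p:B|lborel. r / 2 * norm x - \<phi> x)"
    by (subst set_integral_const) (auto simp: B_def emeasure_compact_finite[THEN less_imp_neq, simplified])
  also have "\<dots> \<le> (LINT p:P|lborel. legendre \<phi> p)"
    unfolding set_lebesgue_integral_def
  proof (rule integral_mono)
    show "integrable lborel (\<lambda>p. indicator B p *\<^sub>R (r / 2 * norm x - \<phi> x))"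
      unfolding B_def by (intro borel_integrable_compact continuous_intros compact_cball)
    show "integrable lborel (\<lambda>p. indicator P p *\<^sub>R legendre \<phi> p)"
      using set_integrable_legendre[OF assms(1,4)] by (simp add: set_integrable_def)
    fix p
    show "indicator B p *\<^sub>R (r / 2 * norm x - \<phi> x) \<le> indicator P p *\<^sub>R legendre \<phi> p"
      using lower BP nonneg by (auto simp: indicator_def)
  qed
  finally show ?thesis .
qed

lemma MT_functional_le_energy:
  fixes P :: "'a::euclidean_space set"
  assumes "compact P" "cball 0 r \<subseteq> P" "r > 0" "\<delta> > 0"
  shows "\<exists>C. \<forall>\<phi>\<in>Pplus P. \<phi> 0 = 0 \<and> (\<forall>x. \<phi> x \<ge> 0) \<longrightarrow>
    MT_functional P \<phi> \<le> (1 - \<delta>) * energy P \<phi> + C"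
proof -
  define v where "v = measure lborel (cball (0::'a) (r / 4))"
  define V where "V = measure lborel P"
  define t where "t = min 1 (\<delta> * v / V)"
  have v: "v > 0"
    unfolding v_def using assms(3) measure_lborel_pos_if_cball_subset[of "cball 0 (r / 4)" 0 "r / 4"] by simp
  have V: "V > 0"
    unfolding V_def by (rule measure_lborel_pos_if_cball_subset[OF assms(1-3)])
  have t: "t > 0" "t \<le> 1" "t * V \<le> \<delta> * v"
    using v V assms(4) by (auto simp: t_def min_def field_simps)
  have "MT_functional P \<phi> \<le> (1 - \<delta>) * energy P \<phi>
      + ln (LINT x|(lborel::'a measure). exp (- (t * (r / 2)) * norm x))"
    if \<phi>: "\<phi> \<in> Pplus P" "\<phi> 0 = 0" "\<And>x. \<phi> x \<ge> 0" for \<phi>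
  proof -
    define I where "I = (LINT p:P|lborel. legendre \<phi> p)"
    have E: "energy P \<phi> = - I / V"
      by (simp add: energy_def I_def V_def)
    have I: "v * (r / 2 * norm x - \<phi> x) \<le> I" for x
      unfolding v_def I_def by (rule legendre_integral_lower_bound[OF assms(1-3) \<phi>(1,2)])
    have I0: "I \<ge> 0"
      using I[of 0] \<phi>(2) by simp
    \<comment> \<open>Scaling by \<open>t\<close> reduces the energy term to \<open>\<delta> * (I / V)\<close>, at the cost of a smaller slope.\<close>
    have "\<phi> x \<ge> t * (r / 2) * norm x - \<delta> * (I / V)" for x
    proof -
      have "r / 2 * norm x - \<phi> x \<le> I / v"
        using I[of x] v by (simp add: field_simps)
      then have "t * (r / 2 * norm x - \<phi> x) \<le> t * (I / v)"
        using t(1) by (intro mult_left_mono) auto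
      also have "\<dots> = t * V * (I / (v * V))"
        using V by simp
      also have "\<dots> \<le> \<delta> * v * (I / (v * V))"
        using t(3) I0 v V by (intro mult_right_mono) auto
      also have "\<dots> = \<delta> * (I / V)"
        using v by simp
      finally have "t * (r / 2) * norm x - \<delta> * (I / V) \<le> t * \<phi> x"
        by (simp add: algebra_simps)
      also have "\<dots> \<le> \<phi> x"
        using t(2) \<phi>(3)[of x] by (simp add: mult_left_le_one_le t(1) less_imp_le)
      finally show ?thesis .
    qed
    then have "ln (LINT x|lborel. exp (- \<phi> x))
        \<le> \<delta> * (I / V) + ln (LINT x|(lborel::'a measure). exp (- (t * (r / 2)) * norm x))"
      using t(1) assms(3) by (intro ln_integral_exp_minus_le Pplus_continuous[OF \<phi>(1)]) auto
    moreover have "(1 - \<delta>) * energy P \<phi> = energy P \<phi> + \<delta> * (I / V)"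
      by (simp add: E left_diff_distrib diff_divide_distrib)
    ultimately show ?thesis
      by (simp add: MT_functional_def)
  qed
  then show ?thesis
    by blast
qed

section \<open>Boundedness and the barycenter\<close>

lemma bdd_above_MT_functional:
  fixes P :: "'a::euclidean_space set"
  assumes "compact P" "cball 0 r \<subseteq> P" "r > 0" "barycenter P = 0"
  shows "bdd_above (MT_functional P ` Pplus P)"
proof -
  have P: "bounded P" "P \<noteq> {}"
    using assms(1-3) by (auto simp: compact_imp_bounded)
  from MT_functional_le_energy[OF assms(1-3), of 1] obtain K where
    K: "\<And>\<psi>. \<psi> \<in> Pplus P \<Longrightarrow> \<psi> 0 = 0 \<Longrightarrow> (\<And>x. \<psi> x \<ge> 0) \<Longrightarrow> MT_functional P \<psi> \<le> K"
    by auto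
  have "MT_functional P \<phi> \<le> K" if \<phi>: "\<phi> \<in> Pplus P" for \<phi>
  proof -
    obtain C where C: "\<And>x. \<phi> x \<ge> r * norm x - C"
      using Pplus_coercive[OF P(1) assms(2,3) \<phi>] by blast
    obtain z where z: "\<And>x. \<phi> z \<le> \<phi> x"
      using coercive_attains_minimum[OF Pplus_continuous[OF \<phi>] assms(3) C] by blast
    have "MT_functional P \<phi> = MT_functional P (\<lambda>x. \<phi> (x + z) + (- \<phi> z))"
      using MT_functional_shift[OF assms(1-3) \<phi>, of z "- \<phi> z"] assms(4) by simp
    also have "\<dots> \<le> K"
      using z by (intro K Pplus_shift[OF P \<phi>]) auto
    finally show ?thesis .
  qed
  then show ?thesis
    by (auto intro: bdd_aboveI[of _ K])
qed

lemma barycenter_eq_0_if_bdd_above_MT_functional: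
  fixes P :: "'a::euclidean_space set"
  assumes "compact P" "cball 0 r \<subseteq> P" "r > 0" "bdd_above (MT_functional P ` Pplus P)"
  shows "barycenter P = 0"
proof (rule ccontr)
  assume "barycenter P \<noteq> 0"
  then have b: "barycenter P \<bullet> barycenter P > 0"
    by simp
  have P: "bounded P" "P \<noteq> {}"
    using assms(1-3) by (auto simp: compact_imp_bounded)
  obtain K where K: "\<And>\<phi>. \<phi> \<in> Pplus P \<Longrightarrow> MT_functional P \<phi> \<le> K"
    using assms(4) by (auto simp: bdd_above_def)
  define G where "G = MT_functional P (support_fun P)"
  obtain s where s: "s * (barycenter P \<bullet> barycenter P) > K - G"
    using reals_Archimedean3[OF b] by blast
  have "G + (s *\<^sub>R barycenter P) \<bullet> barycenter P \<le> K"
    using MT_functional_shift[OF assms(1-3) support_fun_in_Pplus[OF P], of "s *\<^sub>R barycenter P" 0]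
      K[OF Pplus_shift[OF P support_fun_in_Pplus[OF P], of "s *\<^sub>R barycenter P" 0]]
    by (simp add: G_def)
  with s show False
    by simp
qed

theorem theorem2p16:
  fixes P :: "(real ^ 'n) set"
  assumes "compact P" and "convex P" and "0 \<in> interior P"
  shows "(\<forall>\<delta>>0. \<exists>C. \<forall>\<phi>\<in>Pplus P. \<phi> 0 = 0 \<and> (\<forall>x. \<phi> x \<ge> 0) \<longrightarrow>
            MT_functional P \<phi> \<le> (1 - \<delta>) * energy P \<phi> + C)
       \<and> (bdd_above (MT_functional P ` Pplus P) \<longleftrightarrow>
            (\<forall>a. \<forall>\<phi>\<in>Pplus P. MT_functional P (\<lambda>x. \<phi> (x + a)) = MT_functional P \<phi>))
       \<and> ((\<forall>a. \<forall>\<phi>\<in>Pplus P. MT_functional P (\<lambda>x. \<phi> (x + a)) = MT_functional P \<phi>) \<longleftrightarrow>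
            barycenter P = 0)"
proof -
  obtain r where r: "r > 0" "cball 0 r \<subseteq> P"
    using assms(3) by (auto simp: mem_interior_cball)
  have P: "bounded P" "P \<noteq> {}"
    using assms(1) r by (auto simp: compact_imp_bounded)
  note shift = MT_functional_shift[OF assms(1) r(2,1), where c = 0, simplified]
  have inv: "(\<forall>a. \<forall>\<phi>\<in>Pplus P. MT_functional P (\<lambda>x. \<phi> (x + a)) = MT_functional P \<phi>)
      \<longleftrightarrow> barycenter P = 0"
  proof
    assume "\<forall>a. \<forall>\<phi>\<in>Pplus P. MT_functional P (\<lambda>x. \<phi> (x + a)) = MT_functional P \<phi>"
    \<comment> \<open>Translating by the barycenter itself changes the functional by its squared norm.\<close>
    then show "barycenter P = 0"
      using shift[OF support_fun_in_Pplus[OF P], of "barycenter P"] support_fun_in_Pplus[OF P] by simp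
  qed (simp add: shift)
  have bdd: "bdd_above (MT_functional P ` Pplus P) \<longleftrightarrow> barycenter P = 0"
    using bdd_above_MT_functional[OF assms(1) r(2,1)]
      barycenter_eq_0_if_bdd_above_MT_functional[OF assms(1) r(2,1)] by (intro iffI)
  show ?thesis
    unfolding inv bdd using MT_functional_le_energy[OF assms(1) r(2,1)] by blast
qed

end
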